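(* Consider either the conservative linear scalar transport equation $u_t+(c(x,t)u)_x=0$, with $f(u)=c(x,t)u$ and $a(u)=c(x,t)$, or the Burgers equation $u_t+(\tfrac12u^2)_x=0$, with $f(u)=\tfrac12u^2$ and $a(u)=\tfrac12u$. At a fixed point $x$ and time $t$, let the scalar Steger-Warming numerical flux be $$\hat f^{SW}(u^L,u^R)=\frac12\Big(f(u^R)+f(u^L)-\big(|a(u^R)|\,u^R-|a(u^L)|\,u^L\big)\Big),\qquad u^L,u^R\in\mathbb{R}.$$ Then $\hat f^{SW}$ is monotone: $\hat f^{SW}(u^L,u^R)$ is non-decreasing in its first variable $u^L$ (for every fixed $u^R$) and non-increasing in its second variable $u^R$ (for every fixed $u^L$).
   Context: All quantities are evaluated at one fixed cell interface $x$ and time $t$, so in the linear case $c=c(x,t)$ is a real number (of arbitrary sign) independent of $u$. The function $a$ satisfies $f(u)=a(u)\,u$ in both cases. *)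

theory Defs
  imports Complex_Main
begin

definition linear_flux :: "(real \<Rightarrow> real \<Rightarrow> real) \<Rightarrow> real \<Rightarrow> real \<Rightarrow> real \<Rightarrow> real" where
  "linear_flux c x t u = c x t * u"

definition linear_speed :: "(real \<Rightarrow> real \<Rightarrow> real) \<Rightarrow> real \<Rightarrow> real \<Rightarrow> real \<Rightarrow> real" where
  "linear_speed c x t u = c x t"

definition burgers_flux :: "real \<Rightarrow> real" where
  "burgers_flux u = 1 / 2 * u\<^sup>2"

(* The factor a in f u = a u * u, hence u/2; this is not the characteristic speed f' u = u. *)
definition burgers_speed :: "real \<Rightarrow> real" where
  "burgers_speed u = 1 / 2 * u"

definition steger_warming_flux ::
  "(real \<Rightarrow> real) \<Rightarrow> (real \<Rightarrow> real) \<Rightarrow> real \<Rightarrow> real \<Rightarrow> real" where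
  "steger_warming_flux f a uL uR =
     1 / 2 * (f uR + f uL - (\<bar>a uR\<bar> * uR - \<bar>a uL\<bar> * uL))"

(* Monotonicity in the sense of monotone schemes; mono and antimono are the non-strict notions. *)
definition monotone_flux :: "(real \<Rightarrow> real \<Rightarrow> real) \<Rightarrow> bool" where
  "monotone_flux F \<longleftrightarrow>
     (\<forall>uR. mono (\<lambda>uL. F uL uR)) \<and> (\<forall>uL. antimono (\<lambda>uR. F uL uR))"

end

theory Submission
  imports Defs
begin

text \<open>
  The Steger-Warming flux is a flux vector splitting
  \<open>f\<^sup>+(u\<^sup>L) + f\<^sup>-(u\<^sup>R)\<close> with \<open>f\<^sup>\<plusminus>(u) = (f(u) \<plusminus> \<bar>a(u)\<bar> u) / 2\<close>.
  As the two arguments are decoupled, monotonicity of the flux amounts to \<open>f\<^sup>+\<close> being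
  non-decreasing and \<open>f\<^sup>-\<close> being non-increasing (\<open>monotone_flux_steger_warming\<close>).

  Because \<open>f(u) = a(u) u\<close>, the split fluxes are \<open>max(0, a(u)) u\<close> and
  \<open>min(0, a(u)) u\<close>. For the transport equation these are linear with slopes
  \<open>max(0, c) \<ge> 0\<close> and \<open>min(0, c) \<le> 0\<close>. For the Burgers equation they are
  \<open>max(0, u)\<^sup>2 / 2\<close> and \<open>min(0, u)\<^sup>2 / 2\<close>: the increasing and the
  decreasing branch of the parabola, each continued by zero. Here the sign change of \<open>a\<close>
  coincides with the minimum of \<open>f\<close>, which is what makes the splitting monotone.
\<close>

lemma monotone_flux_steger_warming:
  assumes "mono (\<lambda>u. f u + \<bar>a u\<bar> * u)" and "antimono (\<lambda>u. f u - \<bar>a u\<bar> * u)"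
  shows "monotone_flux (steger_warming_flux f a)"
  unfolding monotone_flux_def
proof (intro conjI allI)
  fix w
  show "mono (\<lambda>v. steger_warming_flux f a v w)"
  proof (rule monoI)
    fix u v :: real
    assume "u \<le> v"
    from monoD[OF assms(1) this]
    show "steger_warming_flux f a u w \<le> steger_warming_flux f a v w"
      by (simp add: steger_warming_flux_def)
  qed
  show "antimono (\<lambda>v. steger_warming_flux f a w v)"
  proof (rule antimonoI)
    fix u v :: real
    assume "u \<le> v"
    from antimonoD[OF assms(2) this]
    show "steger_warming_flux f a w v \<le> steger_warming_flux f a w u"
      by (simp add: steger_warming_flux_def)
  qed
qed

lemma linear_monotone_flux:
  "monotone_flux (steger_warming_flux (linear_flux c x t) (linear_speed c x t))"
proof (rule monotone_flux_steger_warming)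
  let ?c = "c x t"
  have "(?c + \<bar>?c\<bar>) * u \<le> (?c + \<bar>?c\<bar>) * v" if "u \<le> v" for u v
    using that by (intro mult_left_mono) auto
  then show "mono (\<lambda>u. linear_flux c x t u + \<bar>linear_speed c x t u\<bar> * u)"
    by (intro monoI) (simp add: linear_flux_def linear_speed_def distrib_right)
  have "(?c - \<bar>?c\<bar>) * v \<le> (?c - \<bar>?c\<bar>) * u" if "u \<le> v" for u v
    using that by (intro mult_left_mono_neg) auto
  then show "antimono (\<lambda>u. linear_flux c x t u - \<bar>linear_speed c x t u\<bar> * u)"
    by (intro antimonoI) (simp add: linear_flux_def linear_speed_def left_diff_distrib)
qed

lemma burgers_monotone_flux:
  "monotone_flux (steger_warming_flux burgers_flux burgers_speed)"
proof (rule monotone_flux_steger_warming)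
  have plus: "burgers_flux u + \<bar>burgers_speed u\<bar> * u = (max 0 u)\<^sup>2" for u
    by (auto simp: burgers_flux_def burgers_speed_def power2_eq_square abs_if max_def)
  show "mono (\<lambda>u. burgers_flux u + \<bar>burgers_speed u\<bar> * u)"
    unfolding plus by (intro monoI power_mono) auto
  \<comment> \<open>\<open>max 0 (- u)\<close> stands for \<open>- min 0 u\<close>: squaring is monotone only on nonnegative
    arguments.\<close>
  have minus: "burgers_flux u - \<bar>burgers_speed u\<bar> * u = (max 0 (- u))\<^sup>2" for u
    by (auto simp: burgers_flux_def burgers_speed_def power2_eq_square abs_if max_def)
  show "antimono (\<lambda>u. burgers_flux u - \<bar>burgers_speed u\<bar> * u)"
    unfolding minus by (intro antimonoI power_mono) auto
qed

theorem mainTheorem4: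
  fixes c :: "real \<Rightarrow> real \<Rightarrow> real" and x t :: real
    and f a :: "real \<Rightarrow> real"
  assumes "(f = linear_flux c x t \<and> a = linear_speed c x t)
         \<or> (f = burgers_flux \<and> a = burgers_speed)"
  shows "monotone_flux (steger_warming_flux f a)"
  using assms linear_monotone_flux burgers_monotone_flux by blast

end
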